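(* Let $\Omega\subset\mathbb R^n$ be a Borel set, let $x\in\hat\Omega$, let $f\in L^1_{\rm loc}(\Omega,\mathbb R^m)$, let $\alpha\in\mathbb R^m$, and let $\mathrm{dens}_x^\Omega\in\mathcal L^n\text{-}\mathrm{Dens}_x^\Omega$ be an $\mathcal L^n$-density at $x$ within $\Omega$. Then $f$ is approximately differentiable at $x$ with $D_{\rm ap}f(x)=L$ and with $\alpha$ if and only if $L:\mathbb R^n\to\mathbb R^m$ is a linear map with $$\int_\Omega\frac{|f(y)-\alpha-L(y-x)|}{|y-x|}\,d\,\mathrm{dens}_x^\Omega(y)=0 .$$ If $f$ is approximately differentiable at $x$ with $\alpha$, then $$\alpha=\operatorname*{ap\,lim}_{y\to x}f(y)=\mathrm{pr}f(x)=\int_\Omega f\,d\,\mathrm{dens}_x^\Omega .$$ If there is an open convex cone $K_x\subset\mathbb R^n$ with vertex at $x$ and some $r>0$ such that $K_x\cap B_r(x)\subset\Omega$, then $D_{\rm ap}f(x)$ is unique if it exists.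
   Context: $\mathcal L^n$ is Lebesgue measure, $\mathcal B(\Omega)$ the Borel subsets of $\Omega$. $L^1_{\rm loc}(\Omega,\mathbb R^m)$ is the usual space of classes of $\mathcal L^n$-a.e. equal locally Lebesgue integrable functions. $\mathrm{ba}(\Omega,\mathcal B(\Omega),\mathcal L^n)$ is the space of bounded finitely additive set functions $\mu:\mathcal B(\Omega)\to\mathbb R$ with $\mu(A)=0$ whenever $\mathcal L^n(A)=0$. Integral: for $\mu\ge0$ in this space put $\mu^*(A)=\inf\{\mu(B):A\subset B\in\mathcal B(\Omega)\}$. A function $g:\Omega\to\mathbb R$ is $\mu$-integrable if there are Borel step functions $h_k$ (finitely many values) with $\mu^*(\{|h_k-g|>\varepsilon\})\to0$ for all $\varepsilon>0$ and $\int_\Omega|h_k-h_l|\,d\mu\to0$ as $k,l\to\infty$; then $\int_\Omega g\,d\mu=\lim_k\int_\Omega h_k\,d\mu$. This depends only on the $\mathcal L^n$-a.e. class of $g$; vector functions are treated componentwise. An equality for an integral includes integrability. $\hat\Omega:=\{x\in\overline\Omega:\mathcal L^n(\Omega\cap B_\delta(x))>0\ \forall\delta>0\}$. For $x\in\hat\Omega$, $\mathcal L^n\text{-}\mathrm{Dens}_x^\Omega$ is the set of all $\mu\in\mathrm{ba}(\Omega,\mathcal B(\Omega),\mathcal L^n)$ with $$\liminf_{\delta\downarrow0}\frac{\mathcal L^n(A\cap\Omega\cap B_\delta(x))}{\mathcal L^n(\Omega\cap B_\delta(x))}\le\mu(A)\le\limsup_{\delta\downarrow0}\frac{\mathcal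 L^n(A\cap\Omega\cap B_\delta(x))}{\mathcal L^n(\Omega\cap B_\delta(x))}\quad\forall A\in\mathcal B(\Omega).$$ Precise representative: $\mathrm{pr}f(x):=\int_\Omega f\,d\,\mathrm{dens}_x^\Omega$ with $\mathrm{dens}_x^\Omega\in\mathcal L^n\text{-}\mathrm{Dens}_x^\Omega$ if the integral exists. Approximate limit: $\operatorname{ap\,lim}_{y\to x}g(y)=\beta$ (for $g$ with values in $\mathbb R^m$, $\beta\in\mathbb R^m$) means $\lim_{\delta\downarrow0}\frac{\mathcal L^n(B_\delta(x)\cap\Omega\cap\{|g-\beta|\ge\varepsilon\})}{\mathcal L^n(B_\delta(x)\cap\Omega)}=0$ for all $\varepsilon>0$. The function $f$ is approximately differentiable at $x$ with $\alpha\in\mathbb R^m$ and approximate derivative $D_{\rm ap}f(x):=L$ if $L:\mathbb R^n\to\mathbb R^m$ is linear and $\operatorname{ap\,lim}_{y\to x}\frac{f(y)-\alpha-L(y-x)}{|y-x|}=0$.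
   Formalization: In the equivalence, the zero-integral condition is required for every density in Dens at x instead of one fixed density, because for a single fixed density the "if" direction is false (the density may vanish on a set of upper density 1). *)

theory Defs
  imports "HOL-Analysis.Analysis"
begin

section \<open>Finitely additive set functions and their integral\<close>

definition borel_subsets :: "'a::euclidean_space set \<Rightarrow> 'a set set" where
  "borel_subsets \<Omega> = {A. A \<subseteq> \<Omega> \<and> A \<in> sets borel}"

text \<open>A set function is a total function on sets; only its values on the Borel subsets
  of \<open>\<Omega>\<close> are meaningful.\<close>

definition ba :: "'a::euclidean_space set \<Rightarrow> ('a set \<Rightarrow> real) set" where
  "ba \<Omega> = {\<mu>. additive (borel_subsets \<Omega>) \<mu> \<and>
              bounded (\<mu> ` borel_subsets \<Omega>) \<and>
              (\<forall>A\<in>borel_subsets \<Omega>. A \<in> null_sets lebesgue \<longrightarrow> \<mu> A = 0)}"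

text \<open>The following notions are meant for \<open>\<mu> \<ge> 0\<close> (which holds for all densities below).\<close>

definition ba_outer :: "'a::euclidean_space set \<Rightarrow> ('a set \<Rightarrow> real) \<Rightarrow> 'a set \<Rightarrow> real" where
  "ba_outer \<Omega> \<mu> A = Inf {\<mu> B | B. A \<subseteq> B \<and> B \<in> borel_subsets \<Omega>}"

abbreviation step_function :: "'a::euclidean_space set \<Rightarrow> ('a \<Rightarrow> real) \<Rightarrow> bool" where
  "step_function \<Omega> \<equiv> simple_function (restrict_space borel \<Omega>)"

definition step_integral :: "'a::euclidean_space set \<Rightarrow> ('a set \<Rightarrow> real) \<Rightarrow> ('a \<Rightarrow> real) \<Rightarrow> real" where
  "step_integral \<Omega> \<mu> h = (\<Sum>v\<in>h ` \<Omega>. v * \<mu> {y\<in>\<Omega>. h y = v})"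

definition has_ba_integral ::
    "'a::euclidean_space set \<Rightarrow> ('a set \<Rightarrow> real) \<Rightarrow> ('a \<Rightarrow> real) \<Rightarrow> real \<Rightarrow> bool" where
  "has_ba_integral \<Omega> \<mu> g I \<longleftrightarrow>
     (\<exists>h :: nat \<Rightarrow> 'a \<Rightarrow> real.
        (\<forall>k. step_function \<Omega> (h k)) \<and>
        (\<forall>\<epsilon>>0. (\<lambda>k. ba_outer \<Omega> \<mu> {y\<in>\<Omega>. \<bar>h k y - g y\<bar> > \<epsilon>}) \<longlonglongrightarrow> 0) \<and>
        ((\<lambda>(k, l). step_integral \<Omega> \<mu> (\<lambda>y. \<bar>h k y - h l y\<bar>)) \<longlongrightarrow> 0)
          (sequentially \<times>\<^sub>F sequentially) \<and>
        (\<lambda>k. step_integral \<Omega> \<mu> (h k)) \<longlonglongrightarrow> I)"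

definition has_ba_integral_vec ::
    "'a::euclidean_space set \<Rightarrow> ('a set \<Rightarrow> real) \<Rightarrow> ('a \<Rightarrow> real ^ 'm) \<Rightarrow> real ^ 'm \<Rightarrow> bool" where
  "has_ba_integral_vec \<Omega> \<mu> f \<beta> \<longleftrightarrow> (\<forall>i. has_ba_integral \<Omega> \<mu> (\<lambda>y. f y $ i) (\<beta> $ i))"

section \<open>Densities\<close>

definition dens_points :: "'a::euclidean_space set \<Rightarrow> 'a set" where
  "dens_points \<Omega> = {x\<in>closure \<Omega>. \<forall>\<delta>>0. measure lebesgue (\<Omega> \<inter> ball x \<delta>) > 0}"

definition dens_ratio :: "'a::euclidean_space set \<Rightarrow> 'a \<Rightarrow> 'a set \<Rightarrow> real \<Rightarrow> real" where
  "dens_ratio \<Omega> x A \<delta> =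
     measure lebesgue (A \<inter> \<Omega> \<inter> ball x \<delta>) / measure lebesgue (\<Omega> \<inter> ball x \<delta>)"

text \<open>This set is in general not a singleton. A single member may vanish on a set whose
  upper density at \<open>x\<close> is 1 (if its lower density is 0), so an integral condition on an
  unspecified density is to be imposed on all members.\<close>

definition Dens :: "'a::euclidean_space set \<Rightarrow> 'a \<Rightarrow> ('a set \<Rightarrow> real) set" where
  "Dens \<Omega> x = {\<mu>\<in>ba \<Omega>. \<forall>A\<in>borel_subsets \<Omega>.
      Liminf (at_right 0) (\<lambda>\<delta>. ereal (dens_ratio \<Omega> x A \<delta>)) \<le> ereal (\<mu> A) \<and>
      ereal (\<mu> A) \<le> Limsup (at_right 0) (\<lambda>\<delta>. ereal (dens_ratio \<Omega> x A \<delta>))}"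

text \<open>\<open>\<beta>\<close> is the value at \<open>x\<close> of the precise representative of \<open>f\<close> computed with the
  density \<open>\<mu>\<close>; in particular, the integral exists.\<close>

definition has_precise_rep ::
    "'a::euclidean_space set \<Rightarrow> ('a set \<Rightarrow> real) \<Rightarrow> ('a \<Rightarrow> real ^ 'm) \<Rightarrow> 'a \<Rightarrow> real ^ 'm \<Rightarrow> bool" where
  "has_precise_rep \<Omega> \<mu> f x \<beta> \<longleftrightarrow> \<mu> \<in> Dens \<Omega> x \<and> has_ba_integral_vec \<Omega> \<mu> f \<beta>"

section \<open>Approximate limits and approximate differentiability\<close>

text \<open>Functions represent their a.e. classes on \<open>\<Omega>\<close>; values outside \<open>\<Omega>\<close> are irrelevant.\<close>

definition L1_loc :: "'a::euclidean_space set \<Rightarrow> ('a \<Rightarrow> 'b::euclidean_space) set" where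
  "L1_loc \<Omega> = {f. f \<in> borel_measurable (lebesgue_on \<Omega>) \<and>
                  (\<forall>K. compact K \<and> K \<subseteq> \<Omega> \<longrightarrow> f absolutely_integrable_on K)}"

definition ap_lim ::
    "'a::euclidean_space set \<Rightarrow> ('a \<Rightarrow> 'b::euclidean_space) \<Rightarrow> 'a \<Rightarrow> 'b \<Rightarrow> bool" where
  "ap_lim \<Omega> g x \<beta> \<longleftrightarrow>
     (\<forall>\<epsilon>>0. (dens_ratio \<Omega> x {y. norm (g y - \<beta>) \<ge> \<epsilon>} \<longlongrightarrow> 0) (at_right 0))"

text \<open>The value of the difference quotient at \<open>y = x\<close> is irrelevant, as \<open>{x}\<close> is a null set.\<close>

definition has_ap_derivative ::
    "'a::euclidean_space set \<Rightarrow> ('a \<Rightarrow> 'b::euclidean_space) \<Rightarrow> 'a \<Rightarrow> 'b \<Rightarrow> ('a \<Rightarrow> 'b) \<Rightarrow> bool" where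
  "has_ap_derivative \<Omega> f x \<alpha> L \<longleftrightarrow>
     linear L \<and> ap_lim \<Omega> (\<lambda>y. (f y - \<alpha> - L (y - x)) /\<^sub>R norm (y - x)) x 0"

text \<open>The library's \<open>cone\<close> contains its vertex, which would leave the whole space as the
  only nonempty open cone; here only positive multiples are required.\<close>

definition open_convex_cone_at :: "'a::euclidean_space \<Rightarrow> 'a set \<Rightarrow> bool" where
  "open_convex_cone_at x K \<longleftrightarrow>
     K \<noteq> {} \<and> open K \<and> convex K \<and> (\<forall>y\<in>K. \<forall>t>0. x + t *\<^sub>R (y - x) \<in> K)"

end

theory Submission
  imports Defs
begin

text \<open>An approximate limit \<open>0\<close> of \<open>g \<ge> 0\<close> at \<open>x\<close> is equivalent to \<open>\<integral> g d\<mu> = 0\<close> for all densities \<open>\<mu>\<close> at \<open>x\<close>.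
  If the sets \<open>{g \<ge> \<epsilon>}\<close> have density zero at \<open>x\<close>, then every \<open>\<mu>\<close> vanishes on them, and the
  constant step functions \<open>0\<close> determine the integral. If instead some set \<open>{g \<ge> \<epsilon>}\<close> has positive upper
  density at \<open>x\<close>, then by compactness of \<open>[0, 1]\<close>-valued set functions (Tychonoff) the volume
  ratios along radii where the ratio of this set is bounded below have a cluster point; this is a
  density that is positive on \<open>{g \<ge> \<epsilon>}\<close>, whence \<open>\<integral> g d\<mu> \<noteq> 0\<close>. Uniqueness of the
  derivative holds because a nonzero linear map \<open>M\<close> satisfies \<open>\<bar>M v\<bar> > c \<bar>v\<bar>\<close> on an open part of the
  cone, which by scaling occupies a fixed proportion of every small ball around \<open>x\<close>.\<close>

section \<open>The finitely additive integral\<close>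

text \<open>A density at a point vanishes outside every ball around it but has total mass 1, so it
  is never countably additive. The integral is therefore developed from additivity and sign
  alone.\<close>

locale nonneg_finitely_additive =
  fixes \<Omega> :: "'a::euclidean_space set" and \<mu> :: "'a set \<Rightarrow> real"
  assumes borel_Omega: "\<Omega> \<in> sets borel"
    and additive: "additive (borel_subsets \<Omega>) \<mu>"
    and nonneg: "A \<in> borel_subsets \<Omega> \<Longrightarrow> \<mu> A \<ge> 0"
begin

section \<open>Level sets and integrals of step functions\<close>

lemma borel_subsets_eq: "borel_subsets \<Omega> = sets (restrict_space borel \<Omega>)"
  using borel_Omega by (auto simp: borel_subsets_def sets_restrict_space_iff)

lemma space_Omega: "space (restrict_space borel \<Omega>) = \<Omega>"
  by (simp add: space_restrict_space)

lemma empty_eq_0: "\<mu> {} = 0"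
  using additiveD[OF additive, of "{}" "{}"] by (simp add: borel_subsets_def)

lemma level_set:
  assumes "simple_function (restrict_space borel \<Omega>) H"
  shows "{y\<in>\<Omega>. H y = c} \<in> borel_subsets \<Omega>"
  using simple_functionD(2)[OF assms, of "{c}"]
  by (simp add: borel_subsets_eq space_Omega vimage_def Int_def conj_commute)

lemma finite_additive:
  assumes "finite I" "\<And>i. i \<in> I \<Longrightarrow> A i \<in> borel_subsets \<Omega>" "disjoint_family_on A I"
  shows "\<mu> (\<Union>i\<in>I. A i) = (\<Sum>i\<in>I. \<mu> (A i))"
  using assms
proof (induction I)
  case (insert i I)
  have "A i \<inter> (\<Union>j\<in>I. A j) = {}"
    using insert.prems(2) insert.hyps(2) by (fastforce simp: disjoint_family_on_def)
  moreover have "(\<Union>j\<in>I. A j) \<in> borel_subsets \<Omega>"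
    unfolding borel_subsets_eq
    using insert.prems(1) insert.hyps(1) by (intro sets.finite_UN) (auto simp: borel_subsets_eq)
  moreover have "disjoint_family_on A I"
    using insert.prems(2) by (rule disjoint_family_on_mono[rotated]) auto
  ultimately show ?case
    using insert by (simp add: additiveD[OF additive])
qed (simp add: empty_eq_0)

text \<open>Each level set of the composition is a finite disjoint union of level sets of
  \<open>H\<close>. As \<open>H\<close> may take values in any type, a pair of step functions can
  serve as \<open>H\<close>; its level sets are a common partition on which the two can be compared
  or added.\<close>

lemma step_integral_comp:
  fixes \<phi> :: "'b \<Rightarrow> real"
  assumes H: "simple_function (restrict_space borel \<Omega>) H"
  shows "step_integral \<Omega> \<mu> (\<lambda>y. \<phi> (H y)) = (\<Sum>c\<in>H ` \<Omega>. \<phi> c * \<mu> {y\<in>\<Omega>. H y = c})"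
proof -
  have fin: "finite (H ` \<Omega>)"
    using simple_functionD(1)[OF H] by (simp add: space_Omega)
  have "(\<Sum>c\<in>{c \<in> H ` \<Omega>. \<phi> c = v}. \<phi> c * \<mu> {y\<in>\<Omega>. H y = c}) = v * \<mu> {y\<in>\<Omega>. \<phi> (H y) = v}" for v
  proof -
    have "(\<Sum>c\<in>{c \<in> H ` \<Omega>. \<phi> c = v}. \<mu> {y\<in>\<Omega>. H y = c})
        = \<mu> (\<Union>c\<in>{c \<in> H ` \<Omega>. \<phi> c = v}. {y\<in>\<Omega>. H y = c})"
      using fin level_set[OF H]
      by (intro finite_additive[symmetric]) (auto simp: disjoint_family_on_def)
    also have "(\<Union>c\<in>{c \<in> H ` \<Omega>. \<phi> c = v}. {y\<in>\<Omega>. H y = c}) = {y\<in>\<Omega>. \<phi> (H y) = v}"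
      by auto
    finally show ?thesis
      by (simp add: sum_distrib_left flip: sum_distrib_left)
  qed
  then show ?thesis
    by (subst sum.image_gen[OF fin, of _ \<phi>]) (simp add: step_integral_def image_image)
qed

lemma step_integral_mono:
  assumes "step_function \<Omega> h" "step_function \<Omega> k" "\<And>y. y \<in> \<Omega> \<Longrightarrow> h y \<le> k y"
  shows "step_integral \<Omega> \<mu> h \<le> step_integral \<Omega> \<mu> k"
proof -
  have H: "simple_function (restrict_space borel \<Omega>) (\<lambda>y. (h y, k y))"
    using assms by (intro simple_function_Pair)
  have "step_integral \<Omega> \<mu> (\<lambda>y. fst (h y, k y)) \<le> step_integral \<Omega> \<mu> (\<lambda>y. snd (h y, k y))"
    unfolding step_integral_comp[OF H]
    by (intro sum_mono mult_right_mono nonneg level_set[OF H]) (use assms(3) in auto)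
  then show ?thesis by simp
qed

lemma step_integral_add:
  assumes "step_function \<Omega> h" "step_function \<Omega> k"
  shows "step_integral \<Omega> \<mu> (\<lambda>y. h y + k y) = step_integral \<Omega> \<mu> h + step_integral \<Omega> \<mu> k"
proof -
  have H: "simple_function (restrict_space borel \<Omega>) (\<lambda>y. (h y, k y))"
    using assms by (intro simple_function_Pair)
  show ?thesis
    using step_integral_comp[OF H, of fst] step_integral_comp[OF H, of snd]
      step_integral_comp[OF H, of "\<lambda>p. fst p + snd p"]
    by (simp add: sum.distrib distrib_right)
qed

lemma step_integral_cmult:
  assumes "step_function \<Omega> h"
  shows "step_integral \<Omega> \<mu> (\<lambda>y. c * h y) = c * step_integral \<Omega> \<mu> h"
  using step_integral_comp[OF assms, of "\<lambda>v. c * v"] step_integral_comp[OF assms, of "\<lambda>v. v"]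
  by (simp add: sum_distrib_left mult.assoc)

lemma step_integral_const: "step_integral \<Omega> \<mu> (\<lambda>_. c) = c * \<mu> \<Omega>"
  by (cases "\<Omega> = {}") (simp_all add: step_integral_def empty_eq_0 image_constant_conv)

lemma step_function_indicator:
  assumes "A \<in> borel_subsets \<Omega>"
  shows "step_function \<Omega> (indicator A)"
  using assms by (intro simple_function_indicator) (simp add: borel_subsets_eq)

lemma step_integral_indicator:
  assumes "A \<in> borel_subsets \<Omega>"
  shows "step_integral \<Omega> \<mu> (indicator A) = \<mu> A"
proof -
  have "A \<inter> \<Omega> = A" "\<Omega> \<inter> A = A"
    using assms by (auto simp: borel_subsets_def)
  then have "{y\<in>\<Omega>. indicator A y = (1::real)} = A"
    by (auto simp: indicator_def)
  moreover have "indicator A ` \<Omega> \<subseteq> {0, 1::real}"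
    by (auto simp: indicator_def)
  \<comment> \<open>If \<open>A\<close> is empty or all of \<open>\<Omega>\<close>, one of the
    values 0 and 1 is not attained; its level set is empty and contributes nothing.\<close>
  moreover have "\<mu> {y\<in>\<Omega>. indicator A y = v} = 0" if "v \<notin> indicator A ` \<Omega>" for v :: real
  proof -
    have "{y\<in>\<Omega>. indicator A y = v} = {}"
      using that by auto
    then show ?thesis
      by (simp only: empty_eq_0)
  qed
  ultimately have "step_integral \<Omega> \<mu> (indicator A)
      = (\<Sum>v\<in>{0, 1}. v * \<mu> {y\<in>\<Omega>. indicator A y = (v::real)})"
    unfolding step_integral_def by (intro sum.mono_neutral_left) auto
  also have "\<dots> = \<mu> A"
    using \<open>{y\<in>\<Omega>. indicator A y = 1} = A\<close> by simp
  finally show ?thesis .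
qed

section \<open>The outer set function and integrals of nonnegative functions\<close>

lemma ba_outer_nonneg: "ba_outer \<Omega> \<mu> A \<ge> 0" if "A \<subseteq> \<Omega>"
  \<comment> \<open>\<open>\<Omega>\<close> itself covers \<open>A\<close>, so the infimum is taken
    over a nonempty set.\<close>
  unfolding ba_outer_def using borel_Omega that nonneg
  by (intro cInf_greatest) (auto simp: borel_subsets_def)

lemma ba_outer_le:
  assumes "A \<subseteq> B" "B \<in> borel_subsets \<Omega>"
  shows "ba_outer \<Omega> \<mu> A \<le> \<mu> B"
  unfolding ba_outer_def using assms nonneg
  by (intro cInf_lower bdd_belowI[where m=0]) auto

lemma ba_outer_less:
  assumes "ba_outer \<Omega> \<mu> A < c" "A \<subseteq> \<Omega>"
  obtains B where "A \<subseteq> B" "B \<in> borel_subsets \<Omega>" "\<mu> B < c"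
proof -
  have "{\<mu> B |B. A \<subseteq> B \<and> B \<in> borel_subsets \<Omega>} \<noteq> {}"
    using borel_Omega assms(2) by (auto simp: borel_subsets_def)
  from cInf_lessD[OF this] assms(1) that show ?thesis
    unfolding ba_outer_def by blast
qed

text \<open>The constant sequence \<open>c\<close> of step functions works: its exceptional sets
  have outer value 0 for every index, and the Cauchy condition is trivial.\<close>

lemma has_ba_integral_constI:
  assumes "\<And>\<epsilon>. \<epsilon> > 0 \<Longrightarrow> \<exists>B\<in>borel_subsets \<Omega>. {y\<in>\<Omega>. \<bar>g y - c\<bar> > \<epsilon>} \<subseteq> B \<and> \<mu> B = 0"
  shows "has_ba_integral \<Omega> \<mu> g (c * \<mu> \<Omega>)"
  unfolding has_ba_integral_def
proof (intro exI[of _ "\<lambda>_ _. c"] conjI allI impI)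
  fix \<epsilon> :: real assume "\<epsilon> > 0"
  then obtain B where B: "B \<in> borel_subsets \<Omega>" "{y\<in>\<Omega>. \<bar>g y - c\<bar> > \<epsilon>} \<subseteq> B" "\<mu> B = 0"
    using assms by blast
  then have "ba_outer \<Omega> \<mu> {y\<in>\<Omega>. \<bar>c - g y\<bar> > \<epsilon>} = 0"
    using ba_outer_le[OF B(2,1)] ba_outer_nonneg[of "{y\<in>\<Omega>. \<bar>g y - c\<bar> > \<epsilon>}"]
    by (simp add: abs_minus_commute)
  then show "(\<lambda>k. ba_outer \<Omega> \<mu> {y\<in>\<Omega>. \<bar>c - g y\<bar> > \<epsilon>}) \<longlonglongrightarrow> 0"
    by simp
qed (simp_all add: step_integral_const case_prod_unfold)

text \<open>For the step functions \<open>h k\<close> defining the integral and a Borel set \<open>E\<close> outside of which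
  \<open>h k\<close> is \<open>\<tau>\<close>-close to \<open>g\<close>, one has
  \<open>\<epsilon> * indicator B \<le> h k + \<bar>h k - h l\<bar> + (M + \<epsilon>) * indicator E + \<tau>\<close> on all of \<open>\<Omega>\<close>,
  where \<open>M\<close> bounds \<open>\<bar>h l\<bar>\<close>. Integrating this bounds \<open>\<mu> B\<close>.\<close>

lemma has_ba_integral_0_imp_null:
  assumes int: "has_ba_integral \<Omega> \<mu> g 0" and g: "\<And>y. y \<in> \<Omega> \<Longrightarrow> g y \<ge> 0"
    and B: "B \<in> borel_subsets \<Omega>" and "\<epsilon> > 0" and gB: "\<And>y. y \<in> B \<Longrightarrow> g y \<ge> \<epsilon>"
  shows "\<mu> B = 0"
proof -
  obtain h where h: "\<And>k. step_function \<Omega> (h k)"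
    and outer: "\<And>\<eta>. \<eta> > 0 \<Longrightarrow> (\<lambda>k. ba_outer \<Omega> \<mu> {y\<in>\<Omega>. \<bar>h k y - g y\<bar> > \<eta>}) \<longlonglongrightarrow> 0"
    and cauchy: "((\<lambda>(k, l). step_integral \<Omega> \<mu> (\<lambda>y. \<bar>h k y - h l y\<bar>)) \<longlongrightarrow> 0)
          (sequentially \<times>\<^sub>F sequentially)"
    and lim: "(\<lambda>k. step_integral \<Omega> \<mu> (h k)) \<longlonglongrightarrow> 0"
    using int unfolding has_ba_integral_def by blast
  \<comment> \<open>The summand 3 counts the integrals of \<open>h k\<close>, of
    \<open>\<bar>h k - h l\<bar>\<close> and of the term on \<open>E\<close>, each of which is made
    at most \<open>\<tau>\<close>.\<close>
  have bound: "\<epsilon> * \<mu> B \<le> \<tau> * (\<mu> \<Omega> + 3)" if "\<tau> > 0" for \<tau>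
  proof -
    have "eventually (\<lambda>(k, l). step_integral \<Omega> \<mu> (\<lambda>y. \<bar>h k y - h l y\<bar>) < \<tau>)
        (sequentially \<times>\<^sub>F sequentially)"
      using order_tendstoD(2)[OF cauchy \<open>\<tau> > 0\<close>] by (simp add: case_prod_unfold)
    then obtain l where l: "\<And>k. k \<ge> l \<Longrightarrow> step_integral \<Omega> \<mu> (\<lambda>y. \<bar>h k y - h l y\<bar>) < \<tau>"
      by (auto simp: eventually_prod_sequentially)
    have "finite (h l ` \<Omega>)"
      using simple_functionD(1)[OF h] by (simp add: space_Omega)
    then have "bounded (h l ` \<Omega>)"
      by (rule finite_imp_bounded)
    then obtain M where "M > 0" and M: "\<And>y. y \<in> \<Omega> \<Longrightarrow> \<bar>h l y\<bar> \<le> M"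
      by (auto simp: bounded_pos)
    \<comment> \<open>The bound \<open>M\<close> depends on \<open>l\<close> only. So
      \<open>k\<close> can be chosen after it, with an exceptional set small enough to absorb the
      factor \<open>M + \<epsilon>\<close>.\<close>
    have "\<tau> / (M + \<epsilon>) > 0"
      using that \<open>M > 0\<close> \<open>\<epsilon> > 0\<close> by simp
    then have "eventually (\<lambda>k. k \<ge> l \<and> step_integral \<Omega> \<mu> (h k) < \<tau>
        \<and> ba_outer \<Omega> \<mu> {y\<in>\<Omega>. \<bar>h k y - g y\<bar> > \<tau>} < \<tau> / (M + \<epsilon>)) sequentially"
      by (intro eventually_conj eventually_ge_at_top order_tendstoD(2)[OF lim \<open>\<tau> > 0\<close>]
          order_tendstoD(2)[OF outer[OF \<open>\<tau> > 0\<close>]])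
    then obtain k where k: "k \<ge> l" "step_integral \<Omega> \<mu> (h k) < \<tau>"
      "ba_outer \<Omega> \<mu> {y\<in>\<Omega>. \<bar>h k y - g y\<bar> > \<tau>} < \<tau> / (M + \<epsilon>)"
      by (auto simp: eventually_sequentially)
    obtain E where E: "{y\<in>\<Omega>. \<bar>h k y - g y\<bar> > \<tau>} \<subseteq> E" "E \<in> borel_subsets \<Omega>" "\<mu> E < \<tau> / (M + \<epsilon>)"
      by (rule ba_outer_less[OF k(3)]) auto
    note step = h step_function_indicator[OF B] step_function_indicator[OF E(2)]
    have step_abs: "step_function \<Omega> (\<lambda>y. \<bar>h k y - h l y\<bar>)"
      using h by (intro simple_function_compose1[where g=abs] simple_function_diff)
    have "\<epsilon> * \<mu> B = step_integral \<Omega> \<mu> (\<lambda>y. \<epsilon> * indicator B y)"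
      by (simp add: step_integral_cmult step step_integral_indicator B)
    also have "\<dots> \<le> step_integral \<Omega> \<mu>
        (\<lambda>y. h k y + (\<bar>h k y - h l y\<bar> + ((M + \<epsilon>) * indicator E y + \<tau>)))"
    proof (rule step_integral_mono)
      fix y assume y: "y \<in> \<Omega>"
      show "\<epsilon> * indicator B y \<le> h k y + (\<bar>h k y - h l y\<bar> + ((M + \<epsilon>) * indicator E y + \<tau>))"
      \<comment> \<open>On \<open>E\<close>, \<open>h k y + \<bar>h k y - h l y\<bar>\<close> is at
        least \<open>h l y\<close>, hence at least \<open>- M\<close>. Off \<open>E\<close>,
        \<open>h k y + \<tau>\<close> is at least \<open>g y\<close>, which is at least
        \<open>\<epsilon>\<close> on \<open>B\<close> and nonnegative elsewhere.\<close>
      proof (cases "y \<in> E")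
        case True
        then show ?thesis
          using M[OF y] that \<open>\<epsilon> > 0\<close> by (auto simp: indicator_def)
      next
        case False
        then have "\<bar>h k y - g y\<bar> \<le> \<tau>"
          using E(1) y by force
        then show ?thesis
          using False gB[of y] g[OF y] by (auto simp: indicator_def)
      qed
    qed (intro simple_function_add simple_function_mult simple_function_const step step_abs)+
    also have "\<dots> = step_integral \<Omega> \<mu> (h k) + (step_integral \<Omega> \<mu> (\<lambda>y. \<bar>h k y - h l y\<bar>)
        + ((M + \<epsilon>) * \<mu> E + \<tau> * \<mu> \<Omega>))"
      by (simp add: step_integral_add step_integral_cmult step_integral_const step_integral_indicator
          E(2) step step_abs simple_function_add simple_function_mult)
    also have "(M + \<epsilon>) * \<mu> E \<le> \<tau>"
      using E(3) \<open>M > 0\<close> \<open>\<epsilon> > 0\<close> by (simp add: pos_less_divide_eq mult.commute)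
    finally show ?thesis
      using k(2) l[OF k(1)] by (simp add: algebra_simps)
  qed
  have "\<mu> \<Omega> \<ge> 0"
    using borel_Omega by (intro nonneg) (simp add: borel_subsets_def)
  then have "\<epsilon> * \<mu> B \<le> 0 + e" if "e > 0" for e
    using bound[of "e / (\<mu> \<Omega> + 3)"] that by simp
  then have "\<epsilon> * \<mu> B \<le> 0"
    by (rule field_le_epsilon)
  with nonneg[OF B] \<open>\<epsilon> > 0\<close> show ?thesis
    by (simp add: mult_le_0_iff)
qed

end

section \<open>Densities at a point\<close>

text \<open>Level sets of \<open>f\<close> are only Lebesgue measurable, whereas densities are
  meaningful on Borel sets. The outer set \<open>T\<close> serves to show that a density vanishes,
  the inner set \<open>S\<close> to show that it is positive.\<close>

lemma lebesgue_set_between_borel_subsets: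
  assumes "A \<in> sets lebesgue" "A \<subseteq> \<Omega>" "\<Omega> \<in> sets borel"
  obtains S T where "S \<in> borel_subsets \<Omega>" "T \<in> borel_subsets \<Omega>" "S \<subseteq> A" "A \<subseteq> T"
    "T - S \<in> null_sets lebesgue"
proof -
  from assms(1) obtain S N N' where *: "A = S \<union> N" "N \<subseteq> N'" "N' \<in> null_sets lborel" "S \<in> sets lborel"
    by (rule sets_completionE)
  show ?thesis
  proof
    show "S \<in> borel_subsets \<Omega>" "(S \<union> N') \<inter> \<Omega> \<in> borel_subsets \<Omega>" "S \<subseteq> A" "A \<subseteq> (S \<union> N') \<inter> \<Omega>"
      using * assms by (auto simp: borel_subsets_def null_sets_def)
    show "(S \<union> N') \<inter> \<Omega> - S \<in> null_sets lebesgue"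
      by (rule null_sets_completion_subset[of _ N']) (use * in \<open>auto intro: null_sets_completionI\<close>)
  qed
qed

locale density_point =
  fixes \<Omega> :: "'a::euclidean_space set" and x :: 'a
  assumes borel_Omega: "\<Omega> \<in> sets borel"
    and dens_point: "x \<in> dens_points \<Omega>"
begin

section \<open>Elementary properties of the volume ratio\<close>

lemma lebesgue_Omega: "\<Omega> \<in> sets lebesgue"
  using borel_Omega by simp

lemma lmeasurable_Int_ball: "A \<inter> \<Omega> \<in> sets lebesgue \<Longrightarrow> A \<inter> \<Omega> \<inter> ball x \<delta> \<in> lmeasurable"
  by (metis fmeasurable_Int_fmeasurable inf_commute lmeasurable_ball)

lemma measure_Omega_ball_pos: "\<delta> > 0 \<Longrightarrow> measure lebesgue (\<Omega> \<inter> ball x \<delta>) > 0"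
  using dens_point by (simp add: dens_points_def)

text \<open>The null set \<open>N\<close> absorbs the gap between a Lebesgue set and its Borel
  approximations, or the single point \<open>x\<close>. The restriction to the ball admits
  inclusions that hold only near \<open>x\<close>.\<close>

lemma dens_ratio_mono:
  assumes "B \<inter> \<Omega> \<in> sets lebesgue"
    and "N \<in> null_sets lebesgue" and "A \<inter> \<Omega> \<inter> ball x \<delta> \<subseteq> B \<union> N"
  shows "dens_ratio \<Omega> x A \<delta> \<le> dens_ratio \<Omega> x B \<delta>"
proof -
  have "measure lebesgue (A \<inter> \<Omega> \<inter> ball x \<delta>) \<le> measure lebesgue (B \<inter> \<Omega> \<inter> ball x \<delta> \<union> N)"
  \<comment> \<open>A nonmeasurable set has \<open>measure\<close> 0 by convention.\<close>
  proof (cases "A \<inter> \<Omega> \<inter> ball x \<delta> \<in> sets lebesgue")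
    case True
    then show ?thesis
      using assms lmeasurable_Int_ball[OF assms(1)]
      by (intro measure_mono_fmeasurable) (auto intro: fmeasurable.Un fmeasurableI_null_sets)
  qed (simp add: measure_notin_sets)
  also have "\<dots> = measure lebesgue (B \<inter> \<Omega> \<inter> ball x \<delta>)"
    using assms lmeasurable_Int_ball[OF assms(1)] by (intro measure_Un_null_set) auto
  finally show ?thesis
    by (simp add: dens_ratio_def divide_right_mono)
qed

lemma dens_ratio_nonneg: "dens_ratio \<Omega> x A \<delta> \<ge> 0"
  by (simp add: dens_ratio_def)

lemma dens_ratio_Omega: "\<delta> > 0 \<Longrightarrow> dens_ratio \<Omega> x \<Omega> \<delta> = 1"
  using measure_Omega_ball_pos[of \<delta>] by (simp add: dens_ratio_def)

lemma dens_ratio_le_1: "dens_ratio \<Omega> x A \<delta> \<le> 1"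
proof -
  have "dens_ratio \<Omega> x A \<delta> \<le> dens_ratio \<Omega> x \<Omega> \<delta>"
    by (rule dens_ratio_mono[where N="{}"]) (use lebesgue_Omega in auto)
  \<comment> \<open>For nonpositive \<open>\<delta>\<close> the ball is empty and the ratio is 0 / 0
    = 0.\<close>
  also have "\<dots> \<le> 1"
    by (simp add: dens_ratio_def)
  finally show ?thesis .
qed

lemma dens_ratio_Un:
  assumes "A \<in> borel_subsets \<Omega>" "B \<in> borel_subsets \<Omega>" "A \<inter> B = {}"
  shows "dens_ratio \<Omega> x (A \<union> B) \<delta> = dens_ratio \<Omega> x A \<delta> + dens_ratio \<Omega> x B \<delta>"
proof -
  have "A \<inter> \<Omega> \<inter> ball x \<delta> \<in> lmeasurable" "B \<inter> \<Omega> \<inter> ball x \<delta> \<in> lmeasurable"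
    using assms borel_Omega by (auto intro!: lmeasurable_Int_ball simp: borel_subsets_def)
  moreover have "(B \<inter> \<Omega> \<inter> ball x \<delta>) - (A \<inter> \<Omega> \<inter> ball x \<delta>) = B \<inter> \<Omega> \<inter> ball x \<delta>"
    using assms by auto
  moreover have "(A \<union> B) \<inter> \<Omega> \<inter> ball x \<delta> = (A \<inter> \<Omega> \<inter> ball x \<delta>) \<union> (B \<inter> \<Omega> \<inter> ball x \<delta>)"
    by auto
  ultimately show ?thesis
    by (simp only: dens_ratio_def measure_Un2 add_divide_distrib)
qed

lemma dens_ratio_null:
  assumes "A \<in> null_sets lebesgue"
  shows "dens_ratio \<Omega> x A \<delta> = 0"
proof (rule antisym)
  have "dens_ratio \<Omega> x A \<delta> \<le> dens_ratio \<Omega> x {} \<delta>"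
    by (rule dens_ratio_mono[OF _ assms]) auto
  then show "dens_ratio \<Omega> x A \<delta> \<le> 0"
    by (simp add: dens_ratio_def)
qed (rule dens_ratio_nonneg)

section \<open>Densities: forced values and existence\<close>

lemma Dens_between:
  assumes "\<mu> \<in> Dens \<Omega> x" "A \<in> borel_subsets \<Omega>"
  shows "Liminf (at_right 0) (\<lambda>\<delta>. ereal (dens_ratio \<Omega> x A \<delta>)) \<le> ereal (\<mu> A)"
    and "ereal (\<mu> A) \<le> Limsup (at_right 0) (\<lambda>\<delta>. ereal (dens_ratio \<Omega> x A \<delta>))"
  using assms by (auto simp: Dens_def)

text \<open>Where the volume ratios converge, the lower and the upper density coincide and leave no
  freedom: all densities agree on such a set.\<close>

lemma Dens_eqI:
  assumes "\<mu> \<in> Dens \<Omega> x" "A \<in> borel_subsets \<Omega>" "(dens_ratio \<Omega> x A \<longlongrightarrow> c) (at_right 0)"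
  shows "\<mu> A = c"
proof -
  have "((\<lambda>\<delta>. ereal (dens_ratio \<Omega> x A \<delta>)) \<longlongrightarrow> ereal c) (at_right 0)"
    using assms by simp
  from lim_imp_Limsup[OF _ this] lim_imp_Liminf[OF _ this] Dens_between[OF assms(1,2)]
  show ?thesis by simp
qed

lemma Dens_nonneg:
  assumes "\<mu> \<in> Dens \<Omega> x" "A \<in> borel_subsets \<Omega>"
  shows "\<mu> A \<ge> 0"
proof -
  have "0 \<le> Liminf (at_right 0) (\<lambda>\<delta>. ereal (dens_ratio \<Omega> x A \<delta>))"
    by (intro Liminf_bounded always_eventually) (simp add: dens_ratio_nonneg)
  also note Dens_between(1)[OF assms]
  finally show ?thesis by simp
qed

lemma Dens_Omega:
  assumes "\<mu> \<in> Dens \<Omega> x"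
  shows "\<mu> \<Omega> = 1"
proof (rule Dens_eqI[OF assms])
  show "\<Omega> \<in> borel_subsets \<Omega>"
    using borel_Omega by (simp add: borel_subsets_def)
  have "\<forall>\<^sub>F \<delta> in at_right 0. dens_ratio \<Omega> x \<Omega> \<delta> = 1"
    using eventually_at_right_less[of 0] by eventually_elim (rule dens_ratio_Omega)
  then show "(dens_ratio \<Omega> x \<Omega> \<longlongrightarrow> 1) (at_right 0)"
    by (rule tendsto_eventually)
qed

text \<open>A cluster point of the set functions \<open>R \<delta>\<close> in the product topology
  inherits every closed condition that holds eventually. Additivity, the bounds 0 and 1, vanishing
  on a null set and the value at \<open>B\<close> are such conditions, each involving finitely many
  coordinates.\<close>

lemma ex_Dens_ge:
  assumes B: "B \<in> borel_subsets \<Omega>" and freq: "\<exists>\<^sub>F \<delta> in at_right 0. c \<le> dens_ratio \<Omega> x B \<delta>"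
  obtains \<mu> where "\<mu> \<in> Dens \<Omega> x" "c \<le> \<mu> B"
proof -
  define R where "R = (\<lambda>\<delta> A. dens_ratio \<Omega> x A \<delta>)"
  \<comment> \<open>The radii tending to 0, restricted to those where the ratio of \<open>B\<close>
    is at least \<open>c\<close>; \<open>freq\<close> says exactly that this filter is
    proper.\<close>
  define F where "F = inf (at_right 0) (principal {\<delta>. c \<le> R \<delta> B})"
  have F_le: "F \<le> at_right 0"
    by (simp add: F_def)
  have "F \<noteq> bot"
    using freq by (auto simp: F_def R_def trivial_limit_def eventually_inf_principal frequently_def)
  then have "filtermap R F \<noteq> bot"
    by (simp add: filtermap_bot_iff)
  moreover have "eventually (\<lambda>\<nu>. \<nu> \<in> PiE UNIV (\<lambda>_. {0..1})) (filtermap R F)"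
    unfolding eventually_filtermap
    by (intro always_eventually allI PiE_I) (auto simp: R_def dens_ratio_nonneg dens_ratio_le_1)
  \<comment> \<open>Tychonoff: a set function is a point of the product of copies of the unit
    interval indexed by all sets.\<close>
  moreover have "compact (PiE UNIV (\<lambda>_. {0..1}) :: ('a set \<Rightarrow> real) set)"
    using compactin_PiE[of "\<lambda>_. euclidean" "UNIV :: 'a set set" "\<lambda>_. {0..1::real}"]
    by (simp add: euclidean_product_topology)
  ultimately have "\<exists>\<mu>\<in>PiE UNIV (\<lambda>_. {0..1}). inf (nhds \<mu>) (filtermap R F) \<noteq> bot"
    using compact_filter[THEN iffD1, rule_format] by blast
  then obtain \<mu> where nb: "inf (nhds \<mu>) (filtermap R F) \<noteq> bot"
    by blast
  have cluster: "P \<mu>" if "closed {\<nu>. P \<nu>}" "eventually (\<lambda>\<delta>. P (R \<delta>)) F" for P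
  proof (rule ccontr)
    assume "\<not> P \<mu>"
    with that(1) have "eventually (\<lambda>\<nu>. \<nu> \<in> - {\<nu>. P \<nu>}) (nhds \<mu>)"
      by (intro eventually_nhds_in_open) (auto simp: closed_def)
    then have "eventually (\<lambda>\<nu>. \<not> P \<nu>) (nhds \<mu>)"
      by simp
    moreover have "eventually P (filtermap R F)"
      using that(2) by (simp add: eventually_filtermap)
    ultimately have "eventually (\<lambda>\<nu>. False) (inf (nhds \<mu>) (filtermap R F))"
      unfolding eventually_inf by blast
    with nb show False
      by (simp add: trivial_limit_def)
  qed
  have ge: "a \<le> \<mu> A" if "eventually (\<lambda>\<delta>. a \<le> R \<delta> A) F" for a A
    using that by (intro cluster[of "\<lambda>\<nu>. a \<le> \<nu> A"] closed_Collect_le) (auto intro!: continuous_intros)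
  have le: "\<mu> A \<le> a" if "eventually (\<lambda>\<delta>. R \<delta> A \<le> a) F" for a A
    using that by (intro cluster[of "\<lambda>\<nu>. \<nu> A \<le> a"] closed_Collect_le) (auto intro!: continuous_intros)
  have in01: "\<mu> A \<in> {0..1}" for A
    using ge[of 0 A] le[of A 1] by (auto simp: R_def dens_ratio_nonneg dens_ratio_le_1)
  have "\<mu> \<in> ba \<Omega>"
    unfolding ba_def additive_def
  proof (intro CollectI conjI ballI impI)
    fix A C assume "A \<in> borel_subsets \<Omega>" "C \<in> borel_subsets \<Omega>" "A \<inter> C = {}"
    then show "\<mu> (A \<union> C) = \<mu> A + \<mu> C"
      by (intro cluster[of "\<lambda>\<nu>. \<nu> (A \<union> C) = \<nu> A + \<nu> C"] closed_Collect_eq)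
        (auto intro!: continuous_intros simp: R_def dens_ratio_Un)
  next
    show "bounded (\<mu> ` borel_subsets \<Omega>)"
      by (rule bounded_subset[of "{0..1}"]) (use in01 in auto)
  next
    fix A :: "'a set" assume "A \<in> null_sets lebesgue"
    then show "\<mu> A = 0"
      using in01[of A] le[of A 0] by (auto simp: R_def dens_ratio_null)
  qed
  moreover have "Liminf (at_right 0) (\<lambda>\<delta>. ereal (dens_ratio \<Omega> x A \<delta>)) \<le> ereal (\<mu> A)" for A
  \<comment> \<open>Any \<open>y\<close> strictly below the lower limit is eventually below the
    ratios along \<open>F\<close>, hence at most \<open>\<mu> A\<close>. An infinite positive
    \<open>y\<close> would make \<open>F\<close> trivial.\<close>
  proof (rule dense_le)
    fix y assume "y < Liminf (at_right 0) (\<lambda>\<delta>. ereal (dens_ratio \<Omega> x A \<delta>))"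
    then have *: "eventually (\<lambda>\<delta>. y < ereal (R \<delta> A)) F"
      unfolding R_def by (intro filter_leD[OF F_le] less_LiminfD)
    then show "y \<le> ereal (\<mu> A)"
    proof (cases y)
      case (real r)
      with * show ?thesis
        using ge[of r A] by (auto simp: eventually_mono)
    qed (use \<open>F \<noteq> bot\<close> in \<open>simp_all add: trivial_limit_def\<close>)
  qed
  moreover have "ereal (\<mu> A) \<le> Limsup (at_right 0) (\<lambda>\<delta>. ereal (dens_ratio \<Omega> x A \<delta>))" for A
  proof (rule dense_ge)
    fix y assume "Limsup (at_right 0) (\<lambda>\<delta>. ereal (dens_ratio \<Omega> x A \<delta>)) < y"
    then have *: "eventually (\<lambda>\<delta>. ereal (R \<delta> A) < y) F"
      unfolding R_def by (intro filter_leD[OF F_le] Limsup_lessD)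
    then show "ereal (\<mu> A) \<le> y"
    proof (cases y)
      case (real r)
      with * show ?thesis
        using le[of A r] by (auto simp: eventually_mono)
    qed (use \<open>F \<noteq> bot\<close> in \<open>simp_all add: trivial_limit_def\<close>)
  qed
  ultimately have "\<mu> \<in> Dens \<Omega> x"
    by (simp add: Dens_def)
  moreover have "c \<le> \<mu> B"
    by (rule ge) (simp add: F_def eventually_inf_principal)
  ultimately show ?thesis
    by (rule that)
qed

lemma Dens_imp_nonneg_finitely_additive:
  assumes "\<mu> \<in> Dens \<Omega> x"
  shows "nonneg_finitely_additive \<Omega> \<mu>"
  by unfold_locales (use assms borel_Omega Dens_nonneg in \<open>auto simp: Dens_def ba_def\<close>)

section \<open>Approximate limits\<close>

lemma dens_ratio_Un_le:
  assumes "A \<inter> \<Omega> \<in> sets lebesgue" "B \<inter> \<Omega> \<in> sets lebesgue"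
  shows "dens_ratio \<Omega> x (A \<union> B) \<delta> \<le> dens_ratio \<Omega> x A \<delta> + dens_ratio \<Omega> x B \<delta>"
proof -
  have "(A \<union> B) \<inter> \<Omega> \<inter> ball x \<delta> = (A \<inter> \<Omega> \<inter> ball x \<delta>) \<union> (B \<inter> \<Omega> \<inter> ball x \<delta>)"
    by auto
  then show ?thesis
    using measure_Un_le[of "A \<inter> \<Omega> \<inter> ball x \<delta>" lebesgue "B \<inter> \<Omega> \<inter> ball x \<delta>"]
      assms[THEN lmeasurable_Int_ball]
    by (simp add: dens_ratio_def fmeasurableD divide_right_mono flip: add_divide_distrib)
qed

lemma dens_ratio_tendsto_0I:
  assumes "(dens_ratio \<Omega> x B \<longlongrightarrow> 0) (at_right 0)"
    and "\<forall>\<^sub>F \<delta> in at_right 0. dens_ratio \<Omega> x A \<delta> \<le> dens_ratio \<Omega> x B \<delta>"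
  shows "(dens_ratio \<Omega> x A \<longlongrightarrow> 0) (at_right 0)"
  by (rule tendsto_sandwich[OF _ assms(2) tendsto_const assms(1)]) (simp add: dens_ratio_nonneg)

lemma level_set_lebesgue:
  fixes g :: "'a \<Rightarrow> 'b::euclidean_space"
  assumes "g \<in> borel_measurable (lebesgue_on \<Omega>)"
  shows "{y. \<epsilon> \<le> norm (g y - c)} \<inter> \<Omega> \<in> sets lebesgue"
proof -
  have "{y \<in> space (lebesgue_on \<Omega>). \<epsilon> \<le> norm (g y - c)} \<in> sets (lebesgue_on \<Omega>)"
    using assms by measurable
  moreover have "{y \<in> space (lebesgue_on \<Omega>). \<epsilon> \<le> norm (g y - c)} = {y. \<epsilon> \<le> norm (g y - c)} \<inter> \<Omega>"
    by auto
  ultimately show ?thesis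
    using lebesgue_Omega by (auto simp: sets_restrict_space_iff)
qed

text \<open>The level sets of \<open>h\<close> lie in those of \<open>g\<close>. This serves to pass
  from a vector function to its components.\<close>

lemma ap_lim_mono:
  fixes g :: "'a \<Rightarrow> 'b::euclidean_space" and h :: "'a \<Rightarrow> 'c::euclidean_space"
  assumes "g \<in> borel_measurable (lebesgue_on \<Omega>)" "ap_lim \<Omega> g x b"
    and "\<And>y. norm (h y - c) \<le> norm (g y - b)"
  shows "ap_lim \<Omega> h x c"
  unfolding ap_lim_def
proof (intro allI impI)
  fix \<epsilon> :: real assume "\<epsilon> > 0"
  then have "(dens_ratio \<Omega> x {y. \<epsilon> \<le> norm (g y - b)} \<longlongrightarrow> 0) (at_right 0)"
    using assms(2) by (simp add: ap_lim_def)
  moreover have "dens_ratio \<Omega> x {y. \<epsilon> \<le> norm (h y - c)} \<delta> \<le> dens_ratio \<Omega> x {y. \<epsilon> \<le> norm (g y - b)} \<delta>"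
    for \<delta>
    using assms(3) order_trans
    by (intro dens_ratio_mono[where N="{}"] level_set_lebesgue assms(1)) blast+
  ultimately show "(dens_ratio \<Omega> x {y. \<epsilon> \<le> norm (h y - c)} \<longlongrightarrow> 0) (at_right 0)"
    by (auto intro: dens_ratio_tendsto_0I)
qed

text \<open>If the difference deviates by \<open>\<epsilon>\<close>, one of the two functions
  deviates by at least \<open>\<epsilon> / 2\<close>, and a union of two sets of density zero has
  density zero.\<close>

lemma ap_lim_diff:
  fixes g h :: "'a \<Rightarrow> 'b::euclidean_space"
  assumes meas: "g \<in> borel_measurable (lebesgue_on \<Omega>)" "h \<in> borel_measurable (lebesgue_on \<Omega>)"
    and lim: "ap_lim \<Omega> g x b" "ap_lim \<Omega> h x c"
  shows "ap_lim \<Omega> (\<lambda>y. g y - h y) x (b - c)"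
  unfolding ap_lim_def
proof (intro allI impI)
  fix \<epsilon> :: real assume "\<epsilon> > 0"
  define A B where "A = {y. \<epsilon> / 2 \<le> norm (g y - b)}" and "B = {y. \<epsilon> / 2 \<le> norm (h y - c)}"
  have AB: "A \<inter> \<Omega> \<in> sets lebesgue" "B \<inter> \<Omega> \<in> sets lebesgue"
    unfolding A_def B_def by (intro meas level_set_lebesgue)+
  have "\<epsilon> / 2 > 0"
    using \<open>\<epsilon> > 0\<close> by simp
  with lim have "(dens_ratio \<Omega> x A \<longlongrightarrow> 0) (at_right 0)" "(dens_ratio \<Omega> x B \<longlongrightarrow> 0) (at_right 0)"
    unfolding ap_lim_def A_def B_def by blast+
  then have "((\<lambda>\<delta>. dens_ratio \<Omega> x A \<delta> + dens_ratio \<Omega> x B \<delta>) \<longlongrightarrow> 0) (at_right 0)"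
    using tendsto_add_zero by blast
  then have "(dens_ratio \<Omega> x (A \<union> B) \<longlongrightarrow> 0) (at_right 0)"
    by (rule tendsto_sandwich[OF _ _ tendsto_const, rotated 2])
      (simp_all add: dens_ratio_nonneg dens_ratio_Un_le[OF AB])
  moreover have "{y. \<epsilon> \<le> norm (g y - h y - (b - c))} \<subseteq> A \<union> B"
  proof
    fix y assume "y \<in> {y. \<epsilon> \<le> norm (g y - h y - (b - c))}"
    moreover have "norm (g y - h y - (b - c)) \<le> norm (g y - b) + norm (h y - c)"
      using norm_triangle_ineq4[of "g y - b" "h y - c"] by (simp add: algebra_simps)
    ultimately show "y \<in> A \<union> B"
      by (simp add: A_def B_def) linarith
  qed
  then have "dens_ratio \<Omega> x {y. \<epsilon> \<le> norm (g y - h y - (b - c))} \<delta> \<le> dens_ratio \<Omega> x (A \<union> B) \<delta>" for \<delta>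
    using AB by (intro dens_ratio_mono[where N="{}"]) (auto simp: Int_Un_distrib2)
  ultimately show "(dens_ratio \<Omega> x {y. \<epsilon> \<le> norm (g y - h y - (b - c))} \<longlongrightarrow> 0) (at_right 0)"
    by (auto intro: dens_ratio_tendsto_0I)
qed

text \<open>The zero function \<open>g - g\<close> would have approximate limit
  \<open>b - c\<close>; at threshold \<open>norm (b - c)\<close> its level set is the whole space,
  of density 1.\<close>

lemma ap_lim_unique:
  fixes g :: "'a \<Rightarrow> 'b::euclidean_space"
  assumes "g \<in> borel_measurable (lebesgue_on \<Omega>)" "ap_lim \<Omega> g x b" "ap_lim \<Omega> g x c"
  shows "b = c"
proof (rule ccontr)
  assume "b \<noteq> c"
  then have "norm (b - c) > 0"
    by simp
  with ap_lim_diff[OF assms(1,1,2,3)]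
  have "(dens_ratio \<Omega> x {y. norm (b - c) \<le> norm (g y - g y - (b - c))} \<longlongrightarrow> 0) (at_right 0)"
    unfolding ap_lim_def by blast
  then have lim: "(dens_ratio \<Omega> x UNIV \<longlongrightarrow> 0) (at_right 0)"
    by (simp add: norm_minus_commute)
  have "\<forall>\<^sub>F \<delta> in at_right 0. dens_ratio \<Omega> x UNIV \<delta> = 1"
    using eventually_at_right_less[of 0]
    by eventually_elim (use dens_ratio_Omega in \<open>simp add: dens_ratio_def\<close>)
  then have "(dens_ratio \<Omega> x UNIV \<longlongrightarrow> 1) (at_right 0)"
    by (rule tendsto_eventually)
  from tendsto_unique[OF _ this lim] show False
    by simp
qed

text \<open>A Borel hull \<open>T\<close> of a level set exceeds it by a null set only, so
  \<open>T\<close> has density zero and every density vanishes on it. The constant \<open>c\<close>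
  then integrates to \<open>c\<close> because the total mass is 1.\<close>

lemma ap_lim_imp_has_ba_integral:
  assumes g: "g \<in> borel_measurable (lebesgue_on \<Omega>)" and lim: "ap_lim \<Omega> g x c"
    and \<mu>: "\<mu> \<in> Dens \<Omega> x"
  shows "has_ba_integral \<Omega> \<mu> g c"
proof -
  interpret nonneg_finitely_additive \<Omega> \<mu>
    using \<mu> by (rule Dens_imp_nonneg_finitely_additive)
  have "\<exists>T\<in>borel_subsets \<Omega>. {y\<in>\<Omega>. \<bar>g y - c\<bar> > \<epsilon>} \<subseteq> T \<and> \<mu> T = 0" if "\<epsilon> > 0" for \<epsilon>
  proof -
    define A where "A = {y. \<epsilon> \<le> norm (g y - c)}"
    have A: "A \<inter> \<Omega> \<in> sets lebesgue"
      unfolding A_def by (rule level_set_lebesgue[OF g])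
    obtain S T where ST: "S \<in> borel_subsets \<Omega>" "T \<in> borel_subsets \<Omega>" "S \<subseteq> A \<inter> \<Omega>" "A \<inter> \<Omega> \<subseteq> T"
      "T - S \<in> null_sets lebesgue"
      using lebesgue_set_between_borel_subsets[OF A _ borel_Omega] by blast
    have "(dens_ratio \<Omega> x T \<longlongrightarrow> 0) (at_right 0)"
    proof (rule dens_ratio_tendsto_0I)
      show "(dens_ratio \<Omega> x A \<longlongrightarrow> 0) (at_right 0)"
        using lim that by (simp add: ap_lim_def A_def)
      show "\<forall>\<^sub>F \<delta> in at_right 0. dens_ratio \<Omega> x T \<delta> \<le> dens_ratio \<Omega> x A \<delta>"
        by (intro always_eventually allI dens_ratio_mono[OF A ST(5)]) (use ST(3) in auto)
    qed
    then have "\<mu> T = 0"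
      by (rule Dens_eqI[OF \<mu> ST(2)])
    moreover have "{y\<in>\<Omega>. \<bar>g y - c\<bar> > \<epsilon>} \<subseteq> T"
      using ST(4) by (auto simp: A_def)
    ultimately show ?thesis
      using ST(2) by blast
  qed
  then have "has_ba_integral \<Omega> \<mu> g (c * \<mu> \<Omega>)"
    by (rule has_ba_integral_constI)
  then show ?thesis
    by (simp add: Dens_Omega[OF \<mu>])
qed

lemma has_ba_integral_0_imp_ap_lim:
  assumes g: "g \<in> borel_measurable (lebesgue_on \<Omega>)" "\<And>y. y \<in> \<Omega> \<Longrightarrow> g y \<ge> 0"
    and int: "\<And>\<mu>. \<mu> \<in> Dens \<Omega> x \<Longrightarrow> has_ba_integral \<Omega> \<mu> g 0"
  shows "ap_lim \<Omega> g x 0"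
proof (rule ccontr)
  assume "\<not> ap_lim \<Omega> g x 0"
  then obtain \<epsilon> where "\<epsilon> > 0"
    and not_lim: "\<not> (dens_ratio \<Omega> x {y. \<epsilon> \<le> norm (g y - 0)} \<longlongrightarrow> 0) (at_right 0)"
    unfolding ap_lim_def by blast
  define A where "A = {y. \<epsilon> \<le> norm (g y - 0)}"
  have A: "A \<inter> \<Omega> \<in> sets lebesgue"
    unfolding A_def by (rule level_set_lebesgue[OF g(1)])
  obtain S T where ST: "S \<in> borel_subsets \<Omega>" "T \<in> borel_subsets \<Omega>" "S \<subseteq> A \<inter> \<Omega>" "A \<inter> \<Omega> \<subseteq> T"
    "T - S \<in> null_sets lebesgue"
    using lebesgue_set_between_borel_subsets[OF A _ borel_Omega] by blast
  have S: "S \<inter> \<Omega> \<in> sets lebesgue"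
    using ST(1) borel_Omega by (auto simp: borel_subsets_def)
  \<comment> \<open>The inner approximation \<open>S\<close> loses only a null set, while
    \<open>g\<close> is still at least \<open>\<epsilon>\<close> on it.\<close>
  have "dens_ratio \<Omega> x A \<delta> \<le> dens_ratio \<Omega> x S \<delta>" for \<delta>
    by (rule dens_ratio_mono[OF S ST(5)]) (use ST(4) in auto)
  then have "\<not> (dens_ratio \<Omega> x S \<longlongrightarrow> 0) (at_right 0)"
    using dens_ratio_tendsto_0I[of S A] not_lim unfolding A_def by auto
  then obtain c where "c > 0" "\<exists>\<^sub>F \<delta> in at_right 0. c \<le> dens_ratio \<Omega> x S \<delta>"
    by (auto simp: tendsto_iff frequently_def not_le dens_ratio_nonneg)
  then obtain \<mu> where \<mu>: "\<mu> \<in> Dens \<Omega> x" "c \<le> \<mu> S"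
    using ex_Dens_ge[OF ST(1)] by blast
  interpret nonneg_finitely_additive \<Omega> \<mu>
    using \<mu>(1) by (rule Dens_imp_nonneg_finitely_additive)
  have "\<epsilon> \<le> g y" if "y \<in> S" for y
  proof -
    have "y \<in> A \<inter> \<Omega>"
      using that ST(3) by blast
    then show ?thesis
      using g(2)[of y] by (simp add: A_def)
  qed
  with int[OF \<mu>(1)] g(2) ST(1) \<open>\<epsilon> > 0\<close> have "\<mu> S = 0"
    by (rule has_ba_integral_0_imp_null)
  with \<mu>(2) \<open>c > 0\<close> show False
    by simp
qed

section \<open>Approximate derivatives\<close>

lemma borel_measurable_quotient:
  fixes f :: "'a \<Rightarrow> 'b::euclidean_space"
  assumes f: "f \<in> borel_measurable (lebesgue_on \<Omega>)" and "linear L"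
  shows "(\<lambda>y. (f y - \<alpha> - L (y - x)) /\<^sub>R norm (y - x)) \<in> borel_measurable (lebesgue_on \<Omega>)"
proof -
  have "continuous_on \<Omega> (\<lambda>y. y - x)"
    by (intro continuous_intros)
  then have "continuous_on \<Omega> (\<lambda>y. L (y - x))"
    using \<open>linear L\<close> by (rule linear_continuous_on_compose)
  then have "(\<lambda>y. L (y - x)) \<in> borel_measurable (lebesgue_on \<Omega>)"
    using lebesgue_Omega by (rule continuous_imp_measurable_on_sets_lebesgue)
  moreover have "(\<lambda>y. norm (y - x)) \<in> borel_measurable (lebesgue_on \<Omega>)"
    by (rule continuous_imp_measurable_on_sets_lebesgue[OF _ lebesgue_Omega]) (intro continuous_intros)
  ultimately show ?thesis
    using f by measurable
qed

text \<open>Where the difference quotient has norm below 1, \<open>f y\<close> differs from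
  \<open>\<alpha>\<close> by at most \<open>(1 + C) * norm (y - x)\<close>, with \<open>C\<close> a
  bound for \<open>L\<close>. In small balls a deviation of \<open>\<epsilon>\<close> therefore
  forces the quotient to be at least 1.\<close>

lemma has_ap_derivative_imp_ap_lim:
  fixes f :: "'a \<Rightarrow> 'b::euclidean_space"
  assumes f: "f \<in> borel_measurable (lebesgue_on \<Omega>)" and der: "has_ap_derivative \<Omega> f x \<alpha> L"
  shows "ap_lim \<Omega> f x \<alpha>"
  unfolding ap_lim_def
proof (intro allI impI)
  fix \<epsilon> :: real assume "\<epsilon> > 0"
  define q where "q = (\<lambda>y. (f y - \<alpha> - L (y - x)) /\<^sub>R norm (y - x))"
  have "linear L" and q: "ap_lim \<Omega> q x 0"
    using der by (auto simp: has_ap_derivative_def q_def)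
  obtain C where "C > 0" and C: "\<And>v. norm (L v) \<le> C * norm v"
    using linear_bounded_pos[OF \<open>linear L\<close>] by blast
  define B where "B = {y. 1 \<le> norm (q y - 0)}"
  have B: "B \<inter> \<Omega> \<in> sets lebesgue"
    unfolding B_def q_def by (rule level_set_lebesgue[OF borel_measurable_quotient[OF f \<open>linear L\<close>]])
  \<comment> \<open>The point \<open>x\<close> is split off because the quotient there is 0 by the
    convention for division by zero.\<close>
  have "{y. \<epsilon> \<le> norm (f y - \<alpha>)} \<inter> \<Omega> \<inter> ball x \<delta> \<subseteq> B \<union> {x}" if "\<delta> < \<epsilon> / (1 + C)" for \<delta>
  proof
    fix y assume y: "y \<in> {y. \<epsilon> \<le> norm (f y - \<alpha>)} \<inter> \<Omega> \<inter> ball x \<delta>"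
    show "y \<in> B \<union> {x}"
    proof (cases "y = x")
      case False
      have "norm (f y - \<alpha>) \<le> norm (f y - \<alpha> - L (y - x)) + norm (L (y - x))"
        using norm_triangle_ineq[of "f y - \<alpha> - L (y - x)" "L (y - x)"] by simp
      moreover have "norm (y - x) * (1 + C) < \<epsilon>"
        using y that \<open>C > 0\<close> by (simp add: dist_norm norm_minus_commute pos_less_divide_eq[symmetric])
      ultimately have "norm (y - x) \<le> norm (f y - \<alpha> - L (y - x))"
        using y C[of "y - x"] by (simp add: algebra_simps)
      then show ?thesis
        using False by (simp add: B_def q_def divide_simps)
    qed simp
  qed
  then have "dens_ratio \<Omega> x {y. \<epsilon> \<le> norm (f y - \<alpha>)} \<delta> \<le> dens_ratio \<Omega> x B \<delta>"
    if "\<delta> < \<epsilon> / (1 + C)" for \<delta>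
    using that by (intro dens_ratio_mono[OF B, of "{x}"]) (auto intro!: null_sets_completionI)
  moreover have "\<forall>\<^sub>F \<delta> in at_right 0. \<delta> < \<epsilon> / (1 + C)"
    using \<open>\<epsilon> > 0\<close> \<open>C > 0\<close> by (intro order_tendstoD(2)[OF tendsto_ident_at]) simp
  ultimately have "\<forall>\<^sub>F \<delta> in at_right 0.
      dens_ratio \<Omega> x {y. \<epsilon> \<le> norm (f y - \<alpha>)} \<delta> \<le> dens_ratio \<Omega> x B \<delta>"
    by (rule eventually_mono[rotated])
  moreover have "(dens_ratio \<Omega> x B \<longlongrightarrow> 0) (at_right 0)"
    using q by (simp add: ap_lim_def B_def)
  ultimately show "(dens_ratio \<Omega> x {y. \<epsilon> \<le> norm (f y - \<alpha>)} \<longlongrightarrow> 0) (at_right 0)"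
    by (rule dens_ratio_tendsto_0I[rotated])
qed

text \<open>A quotient and its norm have the same level sets, so the approximate limit 0 can be
  tested on the nonnegative scalar function.\<close>

lemma has_ap_derivative_iff_has_ba_integral:
  fixes f :: "'a \<Rightarrow> 'b::euclidean_space"
  assumes f: "f \<in> borel_measurable (lebesgue_on \<Omega>)"
  shows "has_ap_derivative \<Omega> f x \<alpha> L \<longleftrightarrow> linear L \<and>
    (\<forall>\<mu>\<in>Dens \<Omega> x. has_ba_integral \<Omega> \<mu> (\<lambda>y. norm (f y - \<alpha> - L (y - x)) / norm (y - x)) 0)"
proof (cases "linear L")
  case True
  define q where "q = (\<lambda>y. (f y - \<alpha> - L (y - x)) /\<^sub>R norm (y - x))"
  have meas: "(\<lambda>y. norm (q y)) \<in> borel_measurable (lebesgue_on \<Omega>)"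
    unfolding q_def by (rule measurable_compose[OF borel_measurable_quotient[OF f True] borel_measurable_norm])
  have "has_ap_derivative \<Omega> f x \<alpha> L \<longleftrightarrow> ap_lim \<Omega> (\<lambda>y. norm (q y)) x 0"
    using True by (simp add: has_ap_derivative_def ap_lim_def q_def)
  also have "\<dots> \<longleftrightarrow> (\<forall>\<mu>\<in>Dens \<Omega> x. has_ba_integral \<Omega> \<mu> (\<lambda>y. norm (q y)) 0)"
    using ap_lim_imp_has_ba_integral[OF meas] has_ba_integral_0_imp_ap_lim[OF meas] by auto
  also have "(\<lambda>y. norm (q y)) = (\<lambda>y. norm (f y - \<alpha> - L (y - x)) / norm (y - x))"
    by (simp add: q_def divide_inverse mult.commute)
  finally show ?thesis
    using True by simp
qed (simp add: has_ap_derivative_def)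

text \<open>Both \<open>K\<close> and the region where \<open>M (y - x)\<close> is larger than
  \<open>c * norm (y - x)\<close> are invariant under dilations about \<open>x\<close>. Dilating one
  ball in their intersection bounds the volume ratios below by a positive constant.\<close>

lemma linear_eq_0_if_ap_lim_0:
  fixes M :: "'a \<Rightarrow> 'b::euclidean_space"
  assumes "linear M" and lim: "ap_lim \<Omega> (\<lambda>y. M (y - x) /\<^sub>R norm (y - x)) x 0"
    and K: "K \<noteq> {}" "open K" "\<And>y t. y \<in> K \<Longrightarrow> t > 0 \<Longrightarrow> x + t *\<^sub>R (y - x) \<in> K"
    and r: "r > 0" "K \<inter> ball x r \<subseteq> \<Omega>"
  shows "M u = 0"
proof (rule ccontr)
  assume "M u \<noteq> 0"
  interpret M: linear M by fact
  have cont: "continuous_on UNIV (\<lambda>y. M (y - x))"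
    by (rule linear_continuous_on_compose[OF _ \<open>linear M\<close>]) (intro continuous_intros)
  \<comment> \<open>The direction \<open>u\<close> need not point into the cone. If \<open>M\<close>
    vanishes at \<open>w - x\<close>, a small shift of \<open>w\<close> along \<open>u\<close> gives
    the value \<open>s *\<^sub>R M u\<close>, which is nonzero.\<close>
  obtain v where "v \<in> K" "M (v - x) \<noteq> 0"
  proof -
    from K(1) obtain w where "w \<in> K" by blast
    with \<open>open K\<close> obtain e where "e > 0" and e: "ball w e \<subseteq> K"
      by (auto simp: open_contains_ball)
    have "u \<noteq> 0"
      using \<open>M u \<noteq> 0\<close> M.zero by auto
    define s where "s = e / (2 * norm u)"
    have "s > 0" "s * norm u < e"
      using \<open>e > 0\<close> \<open>u \<noteq> 0\<close> by (simp_all add: s_def)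
    have "s \<noteq> 0" "w + s *\<^sub>R u \<in> K"
      using \<open>s > 0\<close> \<open>s * norm u < e\<close> e by (auto simp: dist_norm subset_iff)
    moreover have "M (w + s *\<^sub>R u - x) = M (w - x) + s *\<^sub>R M u"
      by (simp add: M.add M.diff M.scaleR)
    ultimately show ?thesis
      using that[of w] that[of "w + s *\<^sub>R u"] \<open>w \<in> K\<close> \<open>M u \<noteq> 0\<close>
      by (cases "M (w - x) = 0") auto
  qed
  then have "v \<noteq> x"
    using M.zero by auto
  \<comment> \<open>Half the quotient at \<open>v\<close>, so that the strict inequality defining
    \<open>U\<close> holds at \<open>v\<close> and on a neighbourhood.\<close>
  define c where "c = norm (M (v - x)) / (2 * norm (v - x))"
  have "c > 0"
    using \<open>v \<noteq> x\<close> \<open>M (v - x) \<noteq> 0\<close> by (simp add: c_def)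
  define U where "U = {y. c * norm (y - x) < norm (M (y - x))}"
  have "v \<in> U"
    using \<open>v \<noteq> x\<close> \<open>M (v - x) \<noteq> 0\<close> by (simp add: U_def c_def)
  have "open U"
    unfolding U_def by (intro open_Collect_less continuous_intros cont)
  with \<open>open K\<close> \<open>v \<in> K\<close> \<open>v \<in> U\<close> obtain \<rho> where "\<rho> > 0" and \<rho>: "ball v \<rho> \<subseteq> K \<inter> U"
    using open_contains_ball[of "K \<inter> U"] by blast
  \<comment> \<open>The ball of radius \<open>s\<close> around \<open>x\<close> contains
    \<open>ball v \<rho>\<close>, so dilation by \<open>\<delta> / s\<close> moves the latter into
    \<open>ball x \<delta>\<close>.\<close>
  define s where "s = norm (v - x) + \<rho>"
  have "s > 0"
    using \<open>\<rho> > 0\<close> by (simp add: s_def add_nonneg_pos)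
  define A where "A = {y. c \<le> norm (M (y - x) /\<^sub>R norm (y - x) - 0)}"
  have bound: "(\<rho> / s) ^ DIM('a) \<le> dens_ratio \<Omega> x A \<delta>" if "0 < \<delta>" "\<delta> < r" for \<delta>
  proof -
    define t where "t = \<delta> / s"
    have "t > 0" "t * s = \<delta>"
      using \<open>s > 0\<close> that by (auto simp: t_def)
    have sub: "ball (x + t *\<^sub>R (v - x)) (t * \<rho>) \<subseteq> A \<inter> \<Omega> \<inter> ball x \<delta>"
    proof
      fix z assume "z \<in> ball (x + t *\<^sub>R (v - x)) (t * \<rho>)"
      \<comment> \<open>The preimage of \<open>z\<close> under the dilation by
        \<open>t\<close>.\<close>
      define y where "y = x + (z - x) /\<^sub>R t"
      have z: "z = x + t *\<^sub>R (y - x)"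
        using \<open>t > 0\<close> by (simp add: y_def)
      have "dist (x + t *\<^sub>R (v - x)) z = t * dist v y"
        unfolding z using \<open>t > 0\<close> by (simp add: dist_norm flip: scaleR_diff_right)
      with \<open>z \<in> _\<close> \<open>t > 0\<close> have vy: "dist v y < \<rho>"
        by simp
      with \<rho> have "y \<in> K" "y \<in> U"
        by auto
      have "norm (y - x) < s"
        using vy norm_triangle_ineq[of "y - v" "v - x"]
        by (simp add: s_def dist_norm norm_minus_commute)
      then have "t * norm (y - x) < \<delta>"
        using \<open>t > 0\<close> \<open>t * s = \<delta>\<close> mult_strict_left_mono by blast
      then have "z \<in> ball x \<delta>"
        using \<open>t > 0\<close> by (simp add: z dist_norm)
      moreover have "z \<in> K"
        unfolding z using K(3) \<open>y \<in> K\<close> \<open>t > 0\<close> by blast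
      ultimately have "z \<in> \<Omega>"
        using r(2) \<open>\<delta> < r\<close> by auto
      have "y \<noteq> x"
        using \<open>y \<in> U\<close> M.zero by (auto simp: U_def)
      then have "z \<in> A"
        using \<open>y \<in> U\<close> \<open>t > 0\<close> by (simp add: A_def U_def z M.scaleR divide_simps)
      with \<open>z \<in> \<Omega>\<close> \<open>z \<in> ball x \<delta>\<close> show "z \<in> A \<inter> \<Omega> \<inter> ball x \<delta>"
        by simp
    qed
    have "(\<lambda>y. M (y - x) /\<^sub>R norm (y - x)) \<in> borel_measurable (lebesgue_on \<Omega>)"
      using borel_measurable_quotient[of "\<lambda>_. 0" "\<lambda>v. - M v" 0] \<open>linear M\<close>
      by (simp add: linear_compose_neg)
    then have A: "A \<inter> \<Omega> \<inter> ball x \<delta> \<in> lmeasurable"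
      unfolding A_def by (intro lmeasurable_Int_ball level_set_lebesgue)
    have "unit_ball_vol DIM('a) * (t * \<rho>) ^ DIM('a) = measure lebesgue (ball (x + t *\<^sub>R (v - x)) (t * \<rho>))"
      using \<open>t > 0\<close> \<open>\<rho> > 0\<close> by (simp add: content_ball)
    also have "\<dots> \<le> measure lebesgue (A \<inter> \<Omega> \<inter> ball x \<delta>)"
      by (rule measure_mono_fmeasurable[OF sub _ A]) auto
    finally have num: "unit_ball_vol DIM('a) * (t * \<rho>) ^ DIM('a) \<le> measure lebesgue (A \<inter> \<Omega> \<inter> ball x \<delta>)" .
    \<comment> \<open>Enlarging the denominator to the volume of the full ball leaves a quotient of
      two ball volumes, which does not depend on \<open>\<delta>\<close>.\<close>
    have "measure lebesgue (\<Omega> \<inter> ball x \<delta>) \<le> measure lebesgue (ball x \<delta>)"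
      using lebesgue_Omega by (intro measure_mono_fmeasurable) auto
    also have "\<dots> = unit_ball_vol DIM('a) * \<delta> ^ DIM('a)"
      using that by (simp add: content_ball)
    finally have den: "measure lebesgue (\<Omega> \<inter> ball x \<delta>) \<le> unit_ball_vol DIM('a) * \<delta> ^ DIM('a)" .
    have "(\<rho> / s) ^ DIM('a) = (unit_ball_vol DIM('a) * (t * \<rho>) ^ DIM('a)) / (unit_ball_vol DIM('a) * \<delta> ^ DIM('a))"
      using that by (simp add: t_def power_mult_distrib power_divide less_imp_neq[OF unit_ball_vol_pos, symmetric])
    also have "\<dots> \<le> dens_ratio \<Omega> x A \<delta>"
      unfolding dens_ratio_def using num den measure_Omega_ball_pos[OF \<open>0 < \<delta>\<close>] \<open>t > 0\<close> \<open>\<rho> > 0\<close>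
      by (intro frac_le) auto
    finally show ?thesis .
  qed
  have "(dens_ratio \<Omega> x A \<longlongrightarrow> 0) (at_right 0)"
    using lim \<open>c > 0\<close> unfolding ap_lim_def A_def by blast
  moreover have "\<forall>\<^sub>F \<delta> in at_right 0. (\<rho> / s) ^ DIM('a) \<le> dens_ratio \<Omega> x A \<delta>"
    using bound r(1) by (auto simp: eventually_at_right_field)
  ultimately have "(\<rho> / s) ^ DIM('a) \<le> 0"
    by (intro tendsto_lowerbound) auto
  with \<open>\<rho> > 0\<close> \<open>s > 0\<close> show False
    by (simp add: not_le flip: not_less)
qed

lemma has_ap_derivative_unique:
  fixes f :: "'a \<Rightarrow> 'b::euclidean_space"
  assumes f: "f \<in> borel_measurable (lebesgue_on \<Omega>)"
    and der: "has_ap_derivative \<Omega> f x \<alpha>1 L1" "has_ap_derivative \<Omega> f x \<alpha>2 L2"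
    and K: "open_convex_cone_at x K" "r > 0" "K \<inter> ball x r \<subseteq> \<Omega>"
  shows "L1 = L2"
proof
  fix u
  \<comment> \<open>Both values are the approximate limit of \<open>f\<close>, so they cancel when
    the two quotients are subtracted.\<close>
  have "\<alpha>1 = \<alpha>2"
    using ap_lim_unique[OF f] has_ap_derivative_imp_ap_lim[OF f] der by blast
  define q where "q = (\<lambda>L y. (f y - \<alpha>1 - L (y - x)) /\<^sub>R norm (y - x))"
  have lin: "linear L1" "linear L2"
    and lim: "ap_lim \<Omega> (q L1) x 0" "ap_lim \<Omega> (q L2) x 0"
    using der \<open>\<alpha>1 = \<alpha>2\<close> by (auto simp: has_ap_derivative_def q_def)
  \<comment> \<open>The order is reversed because \<open>L\<close> enters the quotient with a minus
    sign.\<close>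
  have "ap_lim \<Omega> (\<lambda>y. q L2 y - q L1 y) x (0 - 0)"
    using lim lin f by (intro ap_lim_diff) (auto simp: q_def borel_measurable_quotient)
  also have "(\<lambda>y. q L2 y - q L1 y) = (\<lambda>y. (L1 (y - x) - L2 (y - x)) /\<^sub>R norm (y - x))"
    by (simp add: q_def flip: scaleR_diff_right)
  finally have "ap_lim \<Omega> (\<lambda>y. (L1 (y - x) - L2 (y - x)) /\<^sub>R norm (y - x)) x 0"
    by simp
  then have "L1 u - L2 u = 0"
    using K lin
    by (intro linear_eq_0_if_ap_lim_0[where M="\<lambda>v. L1 v - L2 v" and K=K and r=r] linear_compose_sub)
      (auto simp: open_convex_cone_at_def)
  then show "L1 u = L2 u"
    by simp
qed

end

theorem theorem5p11:
  fixes \<Omega> :: "(real ^ 'n) set" and x :: "real ^ 'n"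
    and f :: "real ^ 'n \<Rightarrow> real ^ 'm" and \<alpha> :: "real ^ 'm"
  assumes "\<Omega> \<in> sets borel"
    and "x \<in> dens_points \<Omega>"
    and "f \<in> L1_loc \<Omega>"
  shows "(\<forall>L. has_ap_derivative \<Omega> f x \<alpha> L \<longleftrightarrow>
            linear L \<and>
            (\<forall>dens\<in>Dens \<Omega> x.
               has_ba_integral \<Omega> dens (\<lambda>y. norm (f y - \<alpha> - L (y - x)) / norm (y - x)) 0)) \<and>
         ((\<exists>L. has_ap_derivative \<Omega> f x \<alpha> L) \<longrightarrow>
            ap_lim \<Omega> f x \<alpha> \<and>
            (\<forall>dens\<in>Dens \<Omega> x.
               has_precise_rep \<Omega> dens f x \<alpha> \<and> has_ba_integral_vec \<Omega> dens f \<alpha>)) \<and>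
         ((\<exists>K r. open_convex_cone_at x K \<and> r > 0 \<and> K \<inter> ball x r \<subseteq> \<Omega>) \<longrightarrow>
            (\<forall>\<alpha>1 L1 \<alpha>2 L2.
               has_ap_derivative \<Omega> f x \<alpha>1 L1 \<and> has_ap_derivative \<Omega> f x \<alpha>2 L2 \<longrightarrow> L1 = L2))"
proof -
  interpret density_point \<Omega> x
    using assms(1,2) by unfold_locales
  have f: "f \<in> borel_measurable (lebesgue_on \<Omega>)"
    using assms(3) by (simp add: L1_loc_def)
  have vec: "has_ba_integral_vec \<Omega> \<mu> f \<alpha>" if lim: "ap_lim \<Omega> f x \<alpha>" and \<mu>: "\<mu> \<in> Dens \<Omega> x" for \<mu>
    unfolding has_ba_integral_vec_def
  proof (intro allI ap_lim_imp_has_ba_integral[OF _ _ \<mu>])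
    fix i
    show "(\<lambda>y. f y $ i) \<in> borel_measurable (lebesgue_on \<Omega>)"
      using f by (rule measurable_compose) simp
    show "ap_lim \<Omega> (\<lambda>y. f y $ i) x (\<alpha> $ i)"
      by (rule ap_lim_mono[OF f lim]) (metis component_le_norm_cart real_norm_def vector_minus_component)
  qed
  show ?thesis
    using has_ap_derivative_iff_has_ba_integral[OF f, of \<alpha>] has_ap_derivative_imp_ap_lim[OF f] vec
      has_ap_derivative_unique[OF f]
    unfolding has_precise_rep_def by (intro conjI) blast+
qed

end
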